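(* Let $X_1,\dots,X_n$ be i.i.d. $N_p(\theta,\Sigma)$ with $\Sigma$ an unknown arbitrary positive definite matrix. Let $\mathcal{H}_p^*=\{\theta\in\mathbb{R}^p:\theta_p\ge0\}$ and let $\mathcal{C}$ be a closed convex cone such that $\mathcal{U}\subseteq\mathcal{C}\subseteq\mathcal{H}_p^*$ for some nonempty $p$-dimensional open set $\mathcal{U}$ contained in $\mathcal{H}_p^*$. Then the likelihood ratio test (LRT) for testing $H_0:\theta=0$ against $H_1:\theta\in\mathcal{C}\setminus\{0\}$ is dominated by the LRT for testing $H_0:\theta=0$ against $H_1:\theta\in\mathcal{H}_p^*\setminus\{0\}$.
   Context: Setting: $n>p$; $\mathcal{M}$ is the set of $p\times p$ positive definite matrices and $\Sigma$ ranges over $\mathcal{M}$. Put $\bar X_n=n^{-1}\sum_i X_i$ and $S_n=\sum_i(X_i-\bar X_n)(X_i-\bar X_n)'$. For a positive definite matrix $A$, let $\langle x,y\rangle_A=x'A^{-1}y$ with norm $\|\cdot\|_A$, and let $\pi_A(x;\mathcal{C})$ be the orthogonal projection of $x$ onto the closed convex cone $\mathcal{C}$ with respect to $\langle\cdot,\cdot\rangle_A$. The LRT against $\mathcal{C}\setminus\{0\}$ uses the statistic $$\frac{\|\pi_{S_n}(n^{1/2}\bar X_n;\mathcal{C})\|_{S_n}^2}{1+\|n^{1/2}\bar X_n-\pi_{S_n}(n^{1/2}\bar X_n;\mathcal{C})\|_{S_n}^2}$$ and rejects $H_0$ when it is $\ge c$, where $c>0$ is determined by the level of significance $\alpha$ through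 the requirement that the supremum over $\Sigma\in\mathcal{M}$ of the rejection probability at $\theta=0$ equals $\alpha$; similarly with $\mathcal{H}_p^*$ in place of $\mathcal{C}$. "Dominated" means: for the same $\alpha$, at every $(\theta,\Sigma)$ with $\theta\in\mathcal{C}\setminus\{0\}$ and $\Sigma\in\mathcal{M}$, the power (rejection probability) of the dominating test is at least that of the dominated test. *)

theory Defs
  imports "HOL-Probability.Probability"
begin

definition pos_def :: "real^'p^'p \<Rightarrow> bool" where
  "pos_def A \<longleftrightarrow> transpose A = A \<and> (\<forall>x. x \<noteq> 0 \<longrightarrow> x \<bullet> (A *v x) > 0)"

definition inner_wrt :: "real^'p^'p \<Rightarrow> real^'p \<Rightarrow> real^'p \<Rightarrow> real" where
  "inner_wrt A x y = x \<bullet> (matrix_inv A *v y)"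

definition norm_wrt :: "real^'p^'p \<Rightarrow> real^'p \<Rightarrow> real" where
  "norm_wrt A x = sqrt (inner_wrt A x x)"

text \<open>For positive definite \<open>A\<close> and a nonempty closed convex set \<open>C\<close> the minimiser is unique,
  so this is the orthogonal projection onto \<open>C\<close> in the \<open>A\<close>-geometry
  (cf. \<^const>\<open>closest_point\<close> for the Euclidean one).\<close>

definition proj_wrt :: "real^'p^'p \<Rightarrow> (real^'p) set \<Rightarrow> real^'p \<Rightarrow> real^'p" where
  "proj_wrt A C x = arg_min_on (\<lambda>y. norm_wrt A (x - y)) C"

definition mv_normal_density :: "real^'p \<Rightarrow> real^'p^'p \<Rightarrow> real^'p \<Rightarrow> real" where
  "mv_normal_density \<theta> \<Sigma> x =
     exp (- inner_wrt \<Sigma> (x - \<theta>) (x - \<theta>) / 2) / sqrt ((2 * pi) ^ CARD('p) * det \<Sigma>)"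

text \<open>The statistical experiment: one sample space carrying the observations
  \<open>X 1, \<dots>, X n\<close>, and for every parameter \<open>(\<theta>, \<Sigma>)\<close> a probability measure
  under which they are i.i.d. normal.\<close>

definition normal_sample ::
  "nat \<Rightarrow> (real^'p \<Rightarrow> real^'p^'p \<Rightarrow> 'w measure) \<Rightarrow> (nat \<Rightarrow> 'w \<Rightarrow> real^'p) \<Rightarrow> bool" where
  "normal_sample n P X \<longleftrightarrow>
     (\<forall>\<theta> \<Sigma>. pos_def \<Sigma> \<longrightarrow>
        prob_space (P \<theta> \<Sigma>) \<and>
        prob_space.indep_vars (P \<theta> \<Sigma>) (\<lambda>_. borel) X {1..n} \<and>
        (\<forall>i\<in>{1..n}. distributed (P \<theta> \<Sigma>) lborel (X i) (\<lambda>x. ennreal (mv_normal_density \<theta> \<Sigma> x))))"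

definition sample_mean :: "nat \<Rightarrow> (nat \<Rightarrow> real^'p) \<Rightarrow> real^'p" where
  "sample_mean n x = (1 / real n) *\<^sub>R (\<Sum>i=1..n. x i)"

definition scatter :: "nat \<Rightarrow> (nat \<Rightarrow> real^'p) \<Rightarrow> real^'p^'p" where
  "scatter n x =
     (\<Sum>i=1..n. (columnvector (x i - sample_mean n x) :: real^1^'p) ** rowvector (x i - sample_mean n x))"

definition LRT_stat :: "nat \<Rightarrow> (real^'p) set \<Rightarrow> (nat \<Rightarrow> real^'p) \<Rightarrow> real" where
  "LRT_stat n C x =
     (let S = scatter n x; z = sqrt (real n) *\<^sub>R sample_mean n x
      in (norm_wrt S (proj_wrt S C z))\<^sup>2 / (1 + (norm_wrt S (z - proj_wrt S C z))\<^sup>2))"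

text \<open>The statistic is meaningful only for a positive definite scatter matrix, which holds almost
  surely when \<open>n > p\<close>; on the remaining null event the test does not reject.\<close>

definition LRT_rejects :: "nat \<Rightarrow> (real^'p) set \<Rightarrow> real \<Rightarrow> (nat \<Rightarrow> real^'p) \<Rightarrow> bool" where
  "LRT_rejects n C c x \<longleftrightarrow> pos_def (scatter n x) \<and> LRT_stat n C x \<ge> c"

definition LRT_power ::
  "nat \<Rightarrow> (real^'p \<Rightarrow> real^'p^'p \<Rightarrow> 'w measure) \<Rightarrow> (nat \<Rightarrow> 'w \<Rightarrow> real^'p) \<Rightarrow>
   (real^'p) set \<Rightarrow> real \<Rightarrow> real^'p \<Rightarrow> real^'p^'p \<Rightarrow> real" where
  "LRT_power n P X C c \<theta> \<Sigma> =
     measure (P \<theta> \<Sigma>) {\<omega> \<in> space (P \<theta> \<Sigma>). LRT_rejects n C c (\<lambda>i. X i \<omega>)}"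

definition LRT_critical_value ::
  "nat \<Rightarrow> (real^'p \<Rightarrow> real^'p^'p \<Rightarrow> 'w measure) \<Rightarrow> (nat \<Rightarrow> 'w \<Rightarrow> real^'p) \<Rightarrow>
   (real^'p) set \<Rightarrow> real \<Rightarrow> real \<Rightarrow> bool" where
  "LRT_critical_value n P X C \<alpha> c \<longleftrightarrow>
     c > 0 \<and> (SUP \<Sigma>\<in>{\<Sigma>. pos_def \<Sigma>}. LRT_power n P X C c 0 \<Sigma>) = \<alpha>"

text \<open>The coordinates of \<^typ>\<open>real^'p\<close> carry no order, so the coordinate playing the role of the
  last one is a parameter.\<close>

definition coord_halfspace :: "'p \<Rightarrow> (real^'p) set" where
  "coord_halfspace l = {\<theta>. \<theta> $ l \<ge> 0}"

end

theory Submission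
  imports Defs
begin

text \<open>Write \<open>z\<close> for the scaled sample mean and \<open>S\<close> for the scatter matrix. By Pythagoras for the
  projection, the test for a cone \<open>C\<close> rejects at level \<open>c\<close> iff some \<open>y \<in> C\<close> satisfies
  \<open>(1 + c) \<parallel>z - y\<parallel>\<^sup>2 + c \<le> \<parallel>z\<parallel>\<^sup>2\<close> in the norm of \<open>S\<close>. The rejection region therefore grows with
  \<open>C\<close> and shrinks with \<open>c\<close>, and it remains to see that the critical value \<open>c\<^sub>H\<close> of the halfspace
  \<open>H\<close> is at most the critical value \<open>c\<^sub>C\<close> of \<open>C\<close>. Under the null hypothesis a sample with
  covariance \<open>B B'\<close> is the \<open>B\<close>-image of a standard one, so varying the covariance amounts to
  replacing \<open>C\<close> by \<open>B\<^sup>-\<^sup>1C\<close>. For maps preserving \<open>H\<close> this shows that the null rejection probability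
  for \<open>H\<close> is constant; for maps that squeeze \<open>H\<close> towards an interior ray of \<open>C\<close> the preimages
  exhaust the interior of \<open>H\<close>. If \<open>c\<^sub>C < c\<^sub>H\<close>, the limit gives that the union of the rejection region
  of \<open>H\<close> and the event \<open>c\<^sub>C < \<parallel>z\<parallel>\<^sup>2 < c\<^sub>H, z \<in> interior H\<close> has probability at most \<open>\<alpha>\<close>. But the
  former has probability \<open>\<alpha>\<close>, and the latter is disjoint from it, open and nonempty.\<close>

section \<open>Positive definite forms and projections\<close>

lemma pos_def_invertible:
  assumes "pos_def A"
  shows "invertible A"
proof -
  have "x = 0" if "A *v x = 0" for x
    using assms that unfolding pos_def_def by (metis inner_zero_right less_irrefl)
  then show ?thesis
    by (metis invertible_left_inverse matrix_left_invertible_ker)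
qed

lemma inner_wrt_eq:
  assumes "invertible A" and "A *v w = y"
  shows "inner_wrt A x y = x \<bullet> w"
proof -
  have "matrix_inv A ** A = mat 1"
    using assms(1) unfolding invertible_def matrix_inv_def by (metis (mono_tags, lifting) someI_ex)
  then have "matrix_inv A *v y = w"
    by (metis assms(2) matrix_vector_mul_assoc matrix_vector_mul_lid)
  then show ?thesis
    by (simp add: inner_wrt_def)
qed

lemma transpose_dot: "x \<bullet> (B *v y) = (transpose B *v x) \<bullet> (y :: real^'n)" for B :: "real^'n^'m"
  by (metis dot_lmul_matrix transpose_matrix_vector)

lemma invertible_transpose: "invertible B \<Longrightarrow> invertible (transpose B)"
  for B :: "real^'n^'n"
  unfolding invertible_def by (metis matrix_transpose_mul transpose_mat)

lemma pos_def_congruence: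
  fixes S B :: "real^'p^'p"
  assumes "pos_def S" and "invertible B"
  shows "pos_def (B ** S ** transpose B)"
  unfolding pos_def_def
proof (intro conjI allI impI)
  show "transpose (B ** S ** transpose B) = B ** S ** transpose B"
    using assms(1) by (simp add: pos_def_def matrix_transpose_mul matrix_mul_assoc)
  fix x :: "real^'p" assume "x \<noteq> 0"
  then have "transpose B *v x \<noteq> 0"
    using assms(2) invertible_transpose matrix_left_invertible_ker unfolding invertible_left_inverse
    by blast
  then show "x \<bullet> ((B ** S ** transpose B) *v x) > 0"
    using assms(1) unfolding pos_def_def
    by (simp add: matrix_vector_mul_assoc[symmetric] transpose_dot[of x B])
qed

lemma pos_def_congruence_iff:
  fixes S B :: "real^'p^'p"
  assumes "invertible B"
  shows "pos_def (B ** S ** transpose B) \<longleftrightarrow> pos_def S"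
proof
  assume *: "pos_def (B ** S ** transpose B)"
  obtain B' where B': "B' ** B = mat 1" "B ** B' = mat 1"
    using assms unfolding invertible_def by blast
  then have "invertible B'"
    unfolding invertible_def by blast
  then have "pos_def (B' ** (B ** S ** transpose B) ** transpose B')"
    by (rule pos_def_congruence[OF *])
  moreover have "B' ** (B ** S ** transpose B) ** transpose B' = (B' ** B) ** S ** transpose (B' ** B)"
    by (simp add: matrix_transpose_mul matrix_mul_assoc)
  ultimately show "pos_def S"
    by (simp add: B')
qed (rule pos_def_congruence[OF _ assms])

text \<open>If \<open>S *v w = y\<close> and \<open>transpose B *v w' = w\<close>, then
  \<open>w'\<close> solves the transformed system for \<open>B *v y\<close>; pairing with these
  solutions avoids computing any inverse.\<close>

lemma inner_wrt_congruence:
  fixes S B :: "real^'p^'p"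
  assumes "invertible S" and "invertible B"
  shows "inner_wrt (B ** S ** transpose B) (B *v x) (B *v y) = inner_wrt S x y"
proof -
  obtain w where w: "S *v w = y"
    by (metis assms(1) invertible_def matrix_vector_mul_assoc matrix_vector_mul_lid)
  obtain w' where w': "transpose B *v w' = w"
    by (metis assms(2) invertible_transpose invertible_def matrix_vector_mul_assoc matrix_vector_mul_lid)
  have "inner_wrt (B ** S ** transpose B) (B *v x) (B *v y) = (B *v x) \<bullet> w'"
    by (rule inner_wrt_eq)
      (use assms w w' in \<open>auto simp: invertible_mult invertible_transpose matrix_vector_mul_assoc[symmetric]\<close>)
  also have "\<dots> = x \<bullet> w"
    using w' by (metis inner_commute transpose_dot)
  also have "\<dots> = inner_wrt S x y"
    using inner_wrt_eq[OF assms(1) w] by simp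
  finally show ?thesis .
qed

lemma pos_def_mat_1: "pos_def (mat 1)"
  by (simp add: pos_def_def)

lemma inner_wrt_mat_1: "inner_wrt (mat 1) x y = x \<bullet> y"
  by (rule inner_wrt_eq) (auto simp: invertible_def intro: exI[of _ "mat 1"])

text \<open>Gram--Schmidt for the form \<open>(x, y) \<mapsto> x \<bullet> S y\<close>, started at a multiple of the \<open>l\<close>-th unit
  vector, so that the change of basis preserves the sign of the \<open>l\<close>-th coordinate.\<close>

lemma pos_def_factorization:
  fixes S :: "real^'p^'p" and l :: 'p
  assumes S: "pos_def S"
  obtains B k where "invertible B" "S = B ** transpose B" "k > 0" "\<And>x. (B *v x) $ l = k * x $ l"
proof -
  have sym: "x \<bullet> (S *v y) = y \<bullet> (S *v x)" for x y
    using S by (metis pos_def_def transpose_dot inner_commute)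
  have pos: "x \<bullet> (S *v x) > 0" if "x \<noteq> 0" for x
    using S that by (simp add: pos_def_def)
  have normalise: "\<exists>k>0. (k *\<^sub>R x) \<bullet> (S *v (k *\<^sub>R x)) = 1" if "x \<noteq> 0" for x
  proof (intro exI conjI)
    let ?q = "x \<bullet> (S *v x)"
    show "1 / sqrt ?q > 0"
      using pos[OF that] by simp
    have "1 / sqrt ?q * (1 / sqrt ?q * ?q) = 1"
      using pos[OF that] by (simp add: real_div_sqrt)
    then show "((1 / sqrt ?q) *\<^sub>R x) \<bullet> (S *v ((1 / sqrt ?q) *\<^sub>R x)) = 1"
      by (simp add: matrix_vector_mult_scaleR)
  qed
  obtain k where k: "k > 0" "(k *\<^sub>R axis l 1) \<bullet> (S *v (k *\<^sub>R axis l (1::real))) = 1"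
    using normalise[of "axis l 1"] by (auto simp: axis_eq_0_iff)
  have "\<exists>b. b l = k *\<^sub>R axis l 1 \<and> (\<forall>i\<in>insert l K. \<forall>j\<in>insert l K. b i \<bullet> (S *v b j) = (if i = j then 1 else 0))"
    if "finite K" "l \<notin> K" for K :: "'p set"
    using that
  proof (induction K)
    case empty
    show ?case
      by (intro exI[of _ "\<lambda>_. k *\<^sub>R axis l 1"]) (use k in auto)
  next
    case (insert i0 K)
    then obtain b where b: "b l = k *\<^sub>R axis l 1"
      "\<And>i j. i \<in> insert l K \<Longrightarrow> j \<in> insert l K \<Longrightarrow> b i \<bullet> (S *v b j) = (if i = j then 1 else 0)"
      by fastforce
    have ne: "i0 \<noteq> l" "i0 \<notin> K"
      using insert by auto
    let ?V = "(\<lambda>i. S *v b i) ` insert l K"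
    \<comment> \<open>Fewer than \<open>CARD('p)\<close> vectors \<open>S *v b i\<close> leave room
      for a nonzero \<open>v\<close> orthogonal to all of them, that is, orthogonal to each
      \<open>b i\<close> in the form of \<open>S\<close>.\<close>
    have "dim ?V \<le> card ?V"
      using insert by (intro dim_le_card) (auto simp: span_superset)
    also have "\<dots> \<le> card (insert l K)"
      using insert by (intro card_image_le) auto
    also have "\<dots> < card (insert i0 (insert l K))"
      using ne by (intro psubset_card_mono) auto
    also have "\<dots> \<le> DIM(real^'p)"
      by (simp add: card_mono)
    finally obtain v where v: "v \<noteq> 0" "\<And>y. y \<in> span ?V \<Longrightarrow> orthogonal v y"
      using orthogonal_to_subspace_exists by blast
    obtain h where h: "h > 0" "(h *\<^sub>R v) \<bullet> (S *v (h *\<^sub>R v)) = 1"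
      using normalise[OF v(1)] by blast
    have orth: "(h *\<^sub>R v) \<bullet> (S *v b i) = 0" if "i \<in> insert l K" for i
      using v(2)[of "S *v b i"] that by (auto simp: orthogonal_def intro: span_base)
    have orth': "b i \<bullet> (S *v (h *\<^sub>R v)) = 0" if "i \<in> insert l K" for i
      using orth[OF that] sym by metis
    show ?case
    proof (intro exI[of _ "b(i0 := h *\<^sub>R v)"] conjI ballI)
      show "(b(i0 := h *\<^sub>R v)) l = k *\<^sub>R axis l 1"
        using b(1) ne by simp
      fix i j assume "i \<in> insert l (insert i0 K)" "j \<in> insert l (insert i0 K)"
      then show "(b(i0 := h *\<^sub>R v)) i \<bullet> (S *v (b(i0 := h *\<^sub>R v)) j) = (if i = j then 1 else 0)"
        using b(2)[of i j] orth[of j] orth'[of i] h(2) ne by (cases "i = i0"; cases "j = i0") auto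
    qed
  qed
  from this[of "UNIV - {l}"] obtain b where b: "b l = k *\<^sub>R axis l 1"
    "\<And>i j. b i \<bullet> (S *v b j) = (if i = j then 1 else 0)"
    by auto
  \<comment> \<open>The rows of \<open>M\<close> are orthonormal for the form of \<open>S\<close>,
    so its inverse \<open>B\<close> is the required factor. Row \<open>l\<close> is a positive
    multiple of the unit vector.\<close>
  define M where "M = (\<chi> i. b i)"
  have "(M ** (S ** transpose M)) $ i $ j = b i \<bullet> (S *v b j)" for i j
    by (simp add: M_def matrix_matrix_mult_def matrix_vector_mult_def transpose_def inner_vec_def)
  then have MSM: "M ** (S ** transpose M) = mat 1"
    by (simp add: vec_eq_iff b(2) mat_def)
  then have inv: "invertible M"
    using invertible_right_inverse by blast
  then obtain B where B: "M ** B = mat 1" "B ** M = mat 1"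
    by (auto simp: invertible_def)
  show ?thesis
  proof
    show "invertible B"
      using B by (auto simp: invertible_def)
    have BT: "transpose M ** transpose B = mat 1"
      using B by (metis matrix_transpose_mul transpose_mat)
    have "S = (B ** M) ** S ** (transpose M ** transpose B)"
      by (simp add: B BT)
    also have "\<dots> = B ** (M ** (S ** transpose M)) ** transpose B"
      by (simp add: matrix_mul_assoc)
    finally show "S = B ** transpose B"
      by (simp add: MSM)
    show "1 / k > 0"
      using k by simp
    fix x
    have "x $ l = (M *v (B *v x)) $ l"
      by (simp add: matrix_vector_mul_assoc B)
    also have "\<dots> = k * (B *v x) $ l"
      by (simp add: matrix_vector_mul_component M_def b inner_axis')
    finally show "(B *v x) $ l = 1 / k * x $ l"
      using k by simp
  qed
qed

lemma inner_wrt_factorization: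
  fixes B :: "real^'p^'p"
  assumes "invertible B"
  shows "inner_wrt (B ** transpose B) (B *v x) (B *v y) = x \<bullet> y"
  using inner_wrt_congruence[of "mat 1" B x y] assms
  by (simp add: inner_wrt_mat_1 pos_def_invertible pos_def_mat_1)

text \<open>With \<open>S = B ** transpose B\<close> the inverse of \<open>B\<close> is an isometry
  onto Euclidean space.\<close>

lemma pos_def_linear_coordinates:
  fixes S :: "real^'p^'p"
  assumes "pos_def S"
  obtains f :: "real^'p \<Rightarrow> real^'p" where "linear f" "inj f" "\<And>x y. inner_wrt S x y = f x \<bullet> f y"
proof -
  obtain B :: "real^'p^'p" where B: "invertible B" "S = B ** transpose B"
    by (rule pos_def_factorization[OF assms]) blast
  then obtain M where M: "M ** B = mat 1" "B ** M = mat 1"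
    by (auto simp: invertible_def)
  have "inner_wrt S x y = (M *v x) \<bullet> (M *v y)" for x y
    using inner_wrt_factorization[OF B(1), of "M *v x" "M *v y"] B(2)
    by (simp add: matrix_vector_mul_assoc M)
  moreover have "inj ((*v) M)"
    using M by (intro inj_matrix_vector_mult) (auto simp: invertible_def)
  ultimately show ?thesis
    by (intro that[of "(*v) M"]) auto
qed

section \<open>Projection onto a closed convex cone\<close>

text \<open>In the coordinates \<open>f\<close> the image of the cone is closed, so a nearest point
  exists. Pythagoras comes from the ray through \<open>p\<close>: on it the distance is minimal at
  \<open>p\<close>, which forces \<open>z - p\<close> to be orthogonal to \<open>p\<close>.\<close>

lemma projection_wrt_convex_cone:
  fixes S :: "real^'p^'p" and z :: "real^'p"
  assumes S: "pos_def S" and C: "closed C" "convex_cone C"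
  defines "p \<equiv> proj_wrt S C z"
  shows "p \<in> C"
    and "\<And>y. y \<in> C \<Longrightarrow> inner_wrt S (z - p) (z - p) \<le> inner_wrt S (z - y) (z - y)"
    and "inner_wrt S z z = inner_wrt S p p + inner_wrt S (z - p) (z - p)"
proof -
  obtain f :: "real^'p \<Rightarrow> real^'p" where f: "linear f" "inj f" "\<And>x y. inner_wrt S x y = f x \<bullet> f y"
    using pos_def_linear_coordinates[OF S] by blast
  have norm: "norm_wrt S x = norm (f x)" for x
    by (simp add: norm_wrt_def f(3) norm_eq_sqrt_inner)
  have "closed (f ` C)" "f ` C \<noteq> {}"
    using closed_injective_linear_image[OF C(1) f(1,2)] C(2) by (auto dest: convex_cone_nonempty)
  then obtain q where "q \<in> f ` C" and q: "\<And>y. y \<in> f ` C \<Longrightarrow> dist (f z) q \<le> dist (f z) y"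
    using distance_attains_inf[of "f ` C" "f z"] by blast
  then obtain p0 where "p0 \<in> C" "q = f p0"
    by blast
  then have "is_arg_min (\<lambda>y. norm_wrt S (z - y)) (\<lambda>y. y \<in> C) p0"
    using q by (auto simp: is_arg_min_linorder norm linear_diff[OF f(1)] dist_norm)
  then have "is_arg_min (\<lambda>y. norm_wrt S (z - y)) (\<lambda>y. y \<in> C) p"
    unfolding p_def proj_wrt_def arg_min_on_def arg_min_def by (rule someI)
  then have p: "p \<in> C" and le: "\<And>y. y \<in> C \<Longrightarrow> norm (f (z - p)) \<le> norm (f (z - y))"
    by (auto simp: is_arg_min_linorder norm)
  show "p \<in> C"
    by fact
  show le2: "inner_wrt S (z - p) (z - p) \<le> inner_wrt S (z - y) (z - y)" if "y \<in> C" for y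
    using power_mono[OF le[OF that], of 2] by (simp add: f(3) power2_norm_eq_inner)
  define P R where "P = f p \<bullet> f p" and "R = f z \<bullet> f p"
  have ray: "P - 2 * R \<le> t\<^sup>2 * P - 2 * t * R" if "t \<ge> 0" for t
  proof -
    have "t *\<^sub>R p \<in> C"
      using C(2) p that by (simp add: convex_cone_scaleR)
    moreover have "inner_wrt S (z - t *\<^sub>R p) (z - t *\<^sub>R p) = f z \<bullet> f z - 2 * t * R + t\<^sup>2 * P" for t
      by (simp add: f(3) P_def R_def linear_diff[OF f(1)] linear_scale[OF f(1)] inner_diff_left
          inner_diff_right inner_commute power2_eq_square)
    from this[of t] this[of 1] have "inner_wrt S (z - p) (z - p) = f z \<bullet> f z - 2 * R + P"
      "inner_wrt S (z - t *\<^sub>R p) (z - t *\<^sub>R p) = f z \<bullet> f z - 2 * t * R + t\<^sup>2 * P"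
      by simp_all
    ultimately show ?thesis
      using le2[of "t *\<^sub>R p"] by simp
  qed
  have "P = R"
  proof (cases "P = 0")
    case True
    then show ?thesis
      by (simp add: P_def R_def)
  next
    case False
    then have P: "P > 0"
      using inner_ge_zero[of "f p"] by (simp add: P_def less_le)
    define t where "t = R / P"
    have R: "R = t * P"
      using P by (simp add: t_def)
    \<comment> \<open>Comparison with the apex gives \<open>P \<le> 2 * R\<close>, so the minimiser
      \<open>t = R / P\<close> over the whole line lies on the ray; comparing \<open>p\<close> with
      this point gives \<open>t = 1\<close>.\<close>
    have "t \<ge> 0"
      using ray[of 0] P by (simp add: t_def)
    from ray[OF this] have "P * (1 - t)\<^sup>2 \<le> 0"
      by (simp add: R power2_eq_square algebra_simps)
    then have "t = 1"
      using P by (simp add: mult_le_0_iff)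
    then show ?thesis
      using R by simp
  qed
  moreover have "inner_wrt S (z - p) (z - p) = f z \<bullet> f z - 2 * R + P"
    by (simp add: f(3) P_def R_def linear_diff[OF f(1)] inner_diff_left inner_diff_right inner_commute)
  ultimately show "inner_wrt S z z = inner_wrt S p p + inner_wrt S (z - p) (z - p)"
    by (simp add: f(3) P_def)
qed

lemma inner_wrt_nonneg: "pos_def S \<Longrightarrow> inner_wrt S x x \<ge> 0"
  by (rule pos_def_linear_coordinates[of S]) auto

lemma norm_wrt_power2: "pos_def S \<Longrightarrow> (norm_wrt S x)\<^sup>2 = inner_wrt S x x"
  by (simp add: norm_wrt_def inner_wrt_nonneg)

text \<open>Since the projection minimises the distance and satisfies Pythagoras, rejection means that
  some point of the cone is close enough to the mean; in this form it is visibly monotone in the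
  cone and equivariant under linear maps.\<close>

lemma LRT_rejects_iff:
  fixes C :: "(real^'p) set"
  assumes "closed C" "convex_cone C" and "c > 0"
  shows "LRT_rejects n C c x \<longleftrightarrow> pos_def (scatter n x) \<and>
    (\<exists>y\<in>C. (1 + c) * inner_wrt (scatter n x) (sqrt n *\<^sub>R sample_mean n x - y) (sqrt n *\<^sub>R sample_mean n x - y) + c
       \<le> inner_wrt (scatter n x) (sqrt n *\<^sub>R sample_mean n x) (sqrt n *\<^sub>R sample_mean n x))"
proof (cases "pos_def (scatter n x)")
  case True
  define S z where "S = scatter n x" and "z = sqrt n *\<^sub>R sample_mean n x"
  define p where "p = proj_wrt S C z"
  have S: "pos_def S"
    using True by (simp add: S_def)
  note proj = projection_wrt_convex_cone[OF S assms(1,2), where z = z, folded p_def]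
  define a d where "a = inner_wrt S z z" and "d = inner_wrt S (z - p) (z - p)"
  have d: "d \<ge> 0"
    by (simp add: d_def inner_wrt_nonneg S)
  have stat: "LRT_stat n C x = (a - d) / (1 + d)"
    using proj(3)
    by (simp add: LRT_stat_def Let_def norm_wrt_power2 S a_def d_def p_def flip: S_def z_def)
  then have "c \<le> LRT_stat n C x \<longleftrightarrow> (1 + c) * d + c \<le> a"
    unfolding stat using d by (simp add: pos_le_divide_eq algebra_simps)
  also have "\<dots> \<longleftrightarrow> (\<exists>y\<in>C. (1 + c) * inner_wrt S (z - y) (z - y) + c \<le> a)"
  proof
    assume "(1 + c) * d + c \<le> a"
    then show "\<exists>y\<in>C. (1 + c) * inner_wrt S (z - y) (z - y) + c \<le> a"
      using proj(1) by (auto simp: d_def)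
  next
    assume "\<exists>y\<in>C. (1 + c) * inner_wrt S (z - y) (z - y) + c \<le> a"
    then obtain y where y: "y \<in> C" "(1 + c) * inner_wrt S (z - y) (z - y) + c \<le> a"
      by blast
    have "(1 + c) * d \<le> (1 + c) * inner_wrt S (z - y) (z - y)"
      using proj(2)[OF y(1)] \<open>c > 0\<close> by (simp add: d_def)
    with y(2) show "(1 + c) * d + c \<le> a"
      by linarith
  qed
  finally show ?thesis
    using S by (simp add: LRT_rejects_def a_def flip: S_def z_def)
qed (simp add: LRT_rejects_def)

section \<open>Linear images of normal distributions\<close>

text \<open>The Jacobian factor is one for translations and point reflections, the two substitutions
  used to identify the linear image of Lebesgue measure.\<close>

lemma nn_integral_lborel_affine:
  fixes c :: "'a::euclidean_space" and \<epsilon> :: real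
  assumes [measurable]: "g \<in> borel_measurable borel" and "\<bar>\<epsilon>\<bar> = 1"
  shows "(\<integral>\<^sup>+x. g (c + \<epsilon> *\<^sub>R x) \<partial>lborel) = (\<integral>\<^sup>+x. g x \<partial>lborel)"
proof -
  have "(lborel :: 'a measure) = distr lborel borel (\<lambda>x. c + \<epsilon> *\<^sub>R x)"
    using assms(2) by (subst lborel_affine[of \<epsilon> c]) (auto simp: density_1)
  then have "(\<integral>\<^sup>+x. g x \<partial>lborel) = (\<integral>\<^sup>+x. g x \<partial>distr lborel borel (\<lambda>x. c + \<epsilon> *\<^sub>R x))"
    by metis
  then show ?thesis
    by (simp add: nn_integral_distr)
qed

lemma borel_measurable_matrix_vector_mult [measurable (raw)]:
  fixes B :: "real^'m^'n"
  assumes "f \<in> borel_measurable M"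
  shows "(\<lambda>x. B *v f x) \<in> borel_measurable M"
  using assms borel_measurable_continuous_onI[OF matrix_vector_mult_linear_continuous_on]
  by (rule measurable_compose)

text \<open>The image of Lebesgue measure is translation invariant, and a translation invariant measure
  is determined up to a constant; this avoids the library's determinant formula, which needs a
  well-ordered index type.\<close>

lemma nn_integral_lborel_linear:
  fixes B :: "real^'p^'p"
  assumes "invertible B"
  obtains \<kappa> where "\<And>g :: real^'p \<Rightarrow> ennreal. g \<in> borel_measurable borel \<Longrightarrow>
    (\<integral>\<^sup>+x. g (B *v x) \<partial>lborel) = \<kappa> * (\<integral>\<^sup>+x. g x \<partial>lborel)"
proof -
  obtain M where M: "B ** M = mat 1"
    using assms by (auto simp: invertible_def)
  \<comment> \<open>A test function of integral one: it defines \<open>\<kappa>\<close> and is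
    linked to an arbitrary \<open>g\<close> by a double integral evaluated in both orders.\<close>
  define u :: "real^'p \<Rightarrow> ennreal" where "u = indicator (box 0 One)"
  have [measurable]: "u \<in> borel_measurable borel"
    by (simp add: u_def)
  have u: "(\<integral>\<^sup>+x. u x \<partial>lborel) = 1"
    by (simp add: u_def inner_sum_left_Basis)
  define \<kappa> where "\<kappa> = (\<integral>\<^sup>+x. u (B *v x) \<partial>lborel)"
  have "(\<integral>\<^sup>+x. g (B *v x) \<partial>lborel) = \<kappa> * (\<integral>\<^sup>+x. g x \<partial>lborel)"
    if [measurable]: "g \<in> borel_measurable borel" for g
  proof -
    have "(\<integral>\<^sup>+x. g (B *v x) \<partial>lborel) = (\<integral>\<^sup>+x. g (B *v x) * (\<integral>\<^sup>+y. u y \<partial>lborel) \<partial>lborel)"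
      by (simp add: u)
    also have "\<dots> = (\<integral>\<^sup>+x. g (B *v x) * (\<integral>\<^sup>+y. u (B *v x + y) \<partial>lborel) \<partial>lborel)"
      using nn_integral_lborel_affine[of u 1 "B *v _"] by simp
    also have "\<dots> = (\<integral>\<^sup>+x. \<integral>\<^sup>+y. g (B *v x) * u (B *v x + y) \<partial>lborel \<partial>lborel)"
      by (simp add: nn_integral_cmult)
    also have "\<dots> = (\<integral>\<^sup>+y. \<integral>\<^sup>+x. g (B *v x) * u (B *v x + y) \<partial>lborel \<partial>lborel)"
      by (rule lborel_pair.Fubini'[symmetric]) measurable
    \<comment> \<open>The shift of \<open>x\<close> by \<open>M *v y\<close> moves \<open>y\<close>
      from \<open>u\<close> to \<open>g\<close>. After the next exchange of integrals, a reflection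
      frees the integral of \<open>g\<close> from \<open>x\<close>.\<close>
    also have "\<dots> = (\<integral>\<^sup>+y. \<integral>\<^sup>+x. g (B *v x - y) * u (B *v x) \<partial>lborel \<partial>lborel)"
    proof (rule nn_integral_cong)
      fix y :: "real^'p"
      have "B *v (x - M *v y) = B *v x - y" for x
        by (simp add: matrix_vector_mult_diff_distrib matrix_vector_mul_assoc M)
      then show "(\<integral>\<^sup>+x. g (B *v x) * u (B *v x + y) \<partial>lborel) = (\<integral>\<^sup>+x. g (B *v x - y) * u (B *v x) \<partial>lborel)"
        using nn_integral_lborel_affine[of "\<lambda>x. g (B *v x) * u (B *v x + y)" 1 "- (M *v y)"] by simp
    qed
    also have "\<dots> = (\<integral>\<^sup>+x. \<integral>\<^sup>+y. g (B *v x - y) * u (B *v x) \<partial>lborel \<partial>lborel)"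
      by (rule lborel_pair.Fubini') measurable
    also have "\<dots> = (\<integral>\<^sup>+x. u (B *v x) * (\<integral>\<^sup>+y. g (B *v x - y) \<partial>lborel) \<partial>lborel)"
      by (simp add: nn_integral_cmult mult.commute)
    also have "\<dots> = (\<integral>\<^sup>+x. u (B *v x) * (\<integral>\<^sup>+y. g y \<partial>lborel) \<partial>lborel)"
      using nn_integral_lborel_affine[of g "-1" "B *v _"] by simp
    also have "\<dots> = \<kappa> * (\<integral>\<^sup>+y. g y \<partial>lborel)"
      by (simp add: nn_integral_multc \<kappa>_def)
    finally show ?thesis .
  qed
  then show ?thesis
    by (rule that)
qed

lemma mv_normal_density_measurable [measurable]: "mv_normal_density \<theta> \<Sigma> \<in> borel_measurable borel"
  unfolding mv_normal_density_def inner_wrt_def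
  by measurable

text \<open>The unknown Jacobian constant cancels because both densities integrate to one, which is why the
  existence of a variable \<open>Y\<close> with the target density is assumed.\<close>

lemma distributed_normal_linear:
  fixes B :: "real^'p^'p"
  assumes B: "invertible B"
    and X: "distributed M lborel X (\<lambda>x. ennreal (mv_normal_density 0 (mat 1) x))"
    and Y: "distributed N lborel Y (\<lambda>x. ennreal (mv_normal_density 0 (B ** transpose B) x))"
    and "prob_space M" "prob_space N"
  shows "distributed M lborel (\<lambda>\<omega>. B *v X \<omega>) (\<lambda>x. ennreal (mv_normal_density 0 (B ** transpose B) x))"
proof -
  interpret M: prob_space M by fact
  interpret N: prob_space N by fact
  have X_meas [measurable]: "X \<in> borel_measurable M"
    using distributed_measurable[OF X] by simp
  define f h where "f = mv_normal_density (0 :: real^'p) (mat 1)"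
    and "h = mv_normal_density (0 :: real^'p) (B ** transpose B)"
  have [measurable]: "f \<in> borel_measurable borel" "h \<in> borel_measurable borel"
    by (simp_all add: f_def h_def)
  have h0: "h x \<ge> 0" for x
    by (auto simp: h_def mv_normal_density_def det_mul intro!: divide_nonneg_nonneg)
  \<comment> \<open>The quotient of the two normalising constants; the exponents agree because
    \<open>B\<close> carries the Euclidean form to that of \<open>B ** transpose B\<close>.\<close>
  define r where "r = sqrt ((2 * pi) ^ CARD('p) * det (B ** transpose B)) / sqrt ((2 * pi) ^ CARD('p))"
  have "det B \<noteq> 0"
    using B by (simp add: invertible_det_nz)
  then have "f x = r * h (B *v x)" for x
    using inner_wrt_factorization[OF B, of x x]
    by (simp add: f_def h_def r_def mv_normal_density_def inner_wrt_mat_1 det_mul)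
  moreover have "r \<ge> 0"
    by (simp add: r_def det_mul)
  ultimately have f: "ennreal (f x) = ennreal r * ennreal (h (B *v x))" for x
    using h0 by (simp add: ennreal_mult)
  obtain \<kappa> where \<kappa>: "\<And>g :: real^'p \<Rightarrow> ennreal. g \<in> borel_measurable borel \<Longrightarrow>
    (\<integral>\<^sup>+x. g (B *v x) \<partial>lborel) = \<kappa> * (\<integral>\<^sup>+x. g x \<partial>lborel)"
    using nn_integral_lborel_linear[OF B] by blast
  have emeasure: "emeasure (distr M lborel (\<lambda>\<omega>. B *v X \<omega>)) A = ennreal r * \<kappa> * emeasure (density lborel (\<lambda>x. ennreal (h x))) A"
    if [measurable]: "A \<in> sets borel" for A
  proof -
    have "emeasure (distr M lborel (\<lambda>\<omega>. B *v X \<omega>)) A = (\<integral>\<^sup>+\<omega>. indicator A (B *v X \<omega>) \<partial>M)"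
      by (subst nn_integral_indicator[symmetric]) (simp_all add: nn_integral_distr del: nn_integral_indicator)
    also have "\<dots> = (\<integral>\<^sup>+x. ennreal (f x) * indicator A (B *v x) \<partial>lborel)"
      using distributed_nn_integral[OF X, of "\<lambda>x. indicator A (B *v x)"] by (simp add: f_def)
    also have "\<dots> = (\<integral>\<^sup>+x. ennreal r * (ennreal (h (B *v x)) * indicator A (B *v x)) \<partial>lborel)"
      by (simp add: f mult.assoc)
    also have "\<dots> = ennreal r * (\<kappa> * (\<integral>\<^sup>+x. ennreal (h x) * indicator A x \<partial>lborel))"
      by (subst nn_integral_cmult) (simp_all add: \<kappa>[of "\<lambda>x. ennreal (h x) * indicator A x"])
    also have "\<dots> = ennreal r * \<kappa> * emeasure (density lborel (\<lambda>x. ennreal (h x))) A"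
      by (simp add: emeasure_density mult.assoc)
    finally show ?thesis .
  qed
  have "emeasure (density lborel (\<lambda>x. ennreal (h x))) UNIV = 1"
    using N.emeasure_space_1 distributed_measurable[OF Y]
    by (simp add: h_def flip: distributed_distr_eq_density[OF Y] add: emeasure_distr)
  moreover have "emeasure (distr M lborel (\<lambda>\<omega>. B *v X \<omega>)) UNIV = 1"
    using M.emeasure_space_1 by (simp add: emeasure_distr)
  ultimately have "ennreal r * \<kappa> = 1"
    using emeasure[of UNIV] by simp
  then have "distr M lborel (\<lambda>\<omega>. B *v X \<omega>) = density lborel (\<lambda>x. ennreal (h x))"
    using emeasure by (intro measure_eqI) auto
  then show ?thesis
    by (simp add: distributed_def h_def)
qed

section \<open>Sample statistics\<close>

lemma scatter_nth:
  "scatter n x $ i $ j = (\<Sum>k=1..n. (x k - sample_mean n x) $ i * (x k - sample_mean n x) $ j)"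
  by (simp add: scatter_def columnvector_def rowvector_def matrix_matrix_mult_def)

lemma scatter_mult_vec:
  "scatter n x *v y = (\<Sum>k=1..n. ((x k - sample_mean n x) \<bullet> y) *\<^sub>R (x k - sample_mean n x))"
proof -
  have "(scatter n x *v y) $ i = (\<Sum>k=1..n. ((x k - sample_mean n x) \<bullet> y) *\<^sub>R (x k - sample_mean n x)) $ i" for i
  proof -
    have "(scatter n x *v y) $ i =
      (\<Sum>j\<in>UNIV. \<Sum>k=1..n. (x k - sample_mean n x) $ i * (x k - sample_mean n x) $ j * y $ j)"
      by (simp add: matrix_vector_mult_def scatter_nth sum_distrib_right)
    also have "\<dots> = (\<Sum>k=1..n. \<Sum>j\<in>UNIV. (x k - sample_mean n x) $ i * (x k - sample_mean n x) $ j * y $ j)"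
      by (rule sum.swap)
    also have "\<dots> = (\<Sum>k=1..n. ((x k - sample_mean n x) \<bullet> y) *\<^sub>R (x k - sample_mean n x)) $ i"
      by (simp add: inner_vec_def sum_distrib_left mult_ac)
    finally show ?thesis .
  qed
  then show ?thesis
    by (simp add: vec_eq_iff)
qed

lemma sample_mean_linear: "sample_mean n (\<lambda>i. B *v x i) = B *v sample_mean n x"
  for B :: "real^'p^'q"
  by (simp add: sample_mean_def matrix_vector_mult_scaleR linear_sum[OF matrix_vector_mul_linear])

lemma scatter_linear: "scatter n (\<lambda>i. B *v x i) = B ** scatter n x ** transpose B"
  for B :: "real^'p^'p"
proof -
  let ?d = "\<lambda>k. x k - sample_mean n x"
  have dot: "(B *v v) \<bullet> y = v \<bullet> (transpose B *v y)" for v y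
    using transpose_dot[of y B v] by (simp only: inner_commute)
  have "scatter n (\<lambda>i. B *v x i) *v y = (B ** scatter n x ** transpose B) *v y" for y
  proof -
    have "scatter n (\<lambda>i. B *v x i) *v y = (\<Sum>k=1..n. ((B *v ?d k) \<bullet> y) *\<^sub>R (B *v ?d k))"
      by (simp only: scatter_mult_vec sample_mean_linear matrix_vector_mult_diff_distrib)
    also have "\<dots> = B *v (\<Sum>k=1..n. (?d k \<bullet> (transpose B *v y)) *\<^sub>R ?d k)"
      by (simp only: dot linear_sum[OF matrix_vector_mul_linear] matrix_vector_mult_scaleR)
    also have "\<dots> = (B ** scatter n x ** transpose B) *v y"
      by (simp only: scatter_mult_vec matrix_vector_mul_assoc[symmetric])
    finally show ?thesis .
  qed
  then show ?thesis
    by (simp add: matrix_eq)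
qed

lemma sample_mean_translate: "n > 0 \<Longrightarrow> sample_mean n (\<lambda>i. x i + v) = sample_mean n x + v"
  by (simp add: sample_mean_def sum.distrib scaleR_add_right sum_constant_scaleR del: sum_constant)

lemma scatter_translate: "n > 0 \<Longrightarrow> scatter n (\<lambda>i. x i + v) = scatter n x"
  by (simp add: scatter_def sample_mean_translate)

text \<open>A scatter matrix is a Gram matrix, hence positive semidefinite.\<close>

lemma pos_def_scatter_iff: "pos_def (scatter n x) \<longleftrightarrow> det (scatter n x) \<noteq> 0"
proof
  assume "det (scatter n x) \<noteq> 0"
  then have inv: "invertible (scatter n x)"
    by (simp add: invertible_det_nz)
  have quad: "y \<bullet> (scatter n x *v y) = (\<Sum>k=1..n. ((x k - sample_mean n x) \<bullet> y)\<^sup>2)" for y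
    by (simp add: scatter_mult_vec inner_sum_right power2_eq_square inner_commute)
  show "pos_def (scatter n x)"
    unfolding pos_def_def
  proof (intro conjI allI impI)
    show "transpose (scatter n x) = scatter n x"
      by (simp add: vec_eq_iff transpose_def scatter_nth mult.commute)
    fix y :: "real^'a" assume "y \<noteq> 0"
    show "y \<bullet> (scatter n x *v y) > 0"
    proof (rule ccontr)
      assume "\<not> ?thesis"
      then have "(\<Sum>k=1..n. ((x k - sample_mean n x) \<bullet> y)\<^sup>2) = 0"
        by (simp add: quad sum_nonneg order_antisym not_less)
      then have "scatter n x *v y = 0"
        by (simp add: scatter_mult_vec sum_nonneg_eq_0_iff)
      then show False
        using inv \<open>y \<noteq> 0\<close> by (metis invertible_left_inverse matrix_left_invertible_ker)
    qed
  qed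
qed (use pos_def_invertible invertible_det_nz in blast)

text \<open>\<^const>\<open>inner_wrt\<close> in terms of determinants (Cramer's rule), for continuity and measurability
  in the matrix.\<close>

definition cramer_form :: "real^'p^'p \<Rightarrow> real^'p \<Rightarrow> real" where
  "cramer_form S x = (\<Sum>k\<in>UNIV. x $ k * det (\<chi> i j. if j = k then x $ i else S $ i $ j))"

lemma inner_wrt_cramer:
  assumes "det S \<noteq> 0"
  shows "inner_wrt S x x = cramer_form S x / det S"
proof -
  have "inner_wrt S x x = x \<bullet> (\<chi> k. det (\<chi> i j. if j = k then x $ i else S $ i $ j) / det S)"
    using assms cramer[OF assms] by (intro inner_wrt_eq) (auto simp: invertible_det_nz)
  then show ?thesis
    by (simp add: cramer_form_def inner_vec_def sum_divide_distrib)
qed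

section \<open>Continuity of the sample statistics\<close>

lemma continuous_on_det:
  fixes A :: "'a::topological_space \<Rightarrow> real^'p^'p"
  assumes "\<And>i j. continuous_on T (\<lambda>x. A x $ i $ j)"
  shows "continuous_on T (\<lambda>x. det (A x))"
  unfolding det_def by (intro continuous_intros assms)

lemma continuous_on_cramer_form:
  fixes S :: "'a::topological_space \<Rightarrow> real^'p^'p"
  assumes "\<And>i j. continuous_on T (\<lambda>x. S x $ i $ j)" and "continuous_on T v"
  shows "continuous_on T (\<lambda>x. cramer_form (S x) (v x))"
proof -
  have entries: "continuous_on T (\<lambda>x. (\<chi> i j. if j = k then v x $ i else S x $ i $ j) $ i $ j)" for i j k
    using assms by (cases "j = k") (auto intro: continuous_intros)
  show ?thesis
    unfolding cramer_form_def
    by (intro continuous_on_sum continuous_on_mult continuous_on_det continuous_on_component[OF assms(2)] entries)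
qed

lemma continuous_on_sample_mean:
  "continuous_on UNIV (sample_mean n :: (nat \<Rightarrow> real^'p) \<Rightarrow> _)"
  unfolding sample_mean_def[abs_def] by (intro continuous_intros continuous_on_product_coordinates)

lemma continuous_on_scatter:
  "continuous_on UNIV (\<lambda>x :: nat \<Rightarrow> real^'p. scatter n x $ i $ j)"
  unfolding scatter_nth
  by (intro continuous_intros continuous_on_product_coordinates continuous_on_sample_mean)

lemma continuous_on_det_scatter: "continuous_on UNIV (\<lambda>x :: nat \<Rightarrow> real^'p. det (scatter n x))"
  by (intro continuous_on_det continuous_on_scatter)

lemma continuous_on_cramer_scatter:
  "continuous_on UNIV (\<lambda>x :: nat \<Rightarrow> real^'p. cramer_form (scatter n x) (sqrt n *\<^sub>R sample_mean n x - y))"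
  by (intro continuous_on_cramer_form continuous_on_scatter continuous_intros continuous_on_sample_mean)

lemma scatter_cong:
  assumes "\<And>i. i \<in> {1..n} \<Longrightarrow> x i = y i"
  shows "sample_mean n x = sample_mean n y" "scatter n x = scatter n y"
proof -
  show *: "sample_mean n x = sample_mean n y"
    using assms by (simp add: sample_mean_def)
  show "scatter n x = scatter n y"
    using assms by (simp add: scatter_def *)
qed

section \<open>Events depending on the observed coordinates\<close>

text \<open>Samples are functions on all of \<open>nat\<close>, observed only at the indices 1 to
  \<open>n\<close>. Events can thus be Borel or open sets in one full product space.\<close>

definition determined_by :: "nat \<Rightarrow> (nat \<Rightarrow> 'a) set \<Rightarrow> bool" where
  "determined_by n A \<longleftrightarrow> (\<forall>x y. (\<forall>i\<in>{1..n}. x i = y i) \<longrightarrow> x \<in> A \<longrightarrow> y \<in> A)"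

lemma determined_byD: "determined_by n A \<Longrightarrow> (\<And>i. i \<in> {1..n} \<Longrightarrow> x i = y i) \<Longrightarrow> x \<in> A \<longleftrightarrow> y \<in> A"
  unfolding determined_by_def by metis

lemma determined_by_LRT_rejects: "determined_by n {x. LRT_rejects n C c x}"
  unfolding determined_by_def
proof (intro allI impI)
  fix x y :: "nat \<Rightarrow> real^'a"
  assume "\<forall>i\<in>{1..n}. x i = y i" and "x \<in> {x. LRT_rejects n C c x}"
  then show "y \<in> {x. LRT_rejects n C c x}"
    using scatter_cong[of n x y] by (simp add: LRT_rejects_def LRT_stat_def)
qed

lemma sets_sample:
  fixes Y :: "nat \<Rightarrow> 'w \<Rightarrow> 'b::second_countable_topology"
  assumes A: "A \<in> sets borel" "determined_by n A"
    and Y: "\<And>i. i \<in> {1..n} \<Longrightarrow> Y i \<in> borel_measurable M"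
  shows "{\<omega> \<in> space M. (\<lambda>i. Y i \<omega>) \<in> A} \<in> sets M"
proof -
  \<comment> \<open>Nothing is known about \<open>Y i\<close> outside 1 to \<open>n\<close>; a
    constant there makes every coordinate measurable without changing membership in
    \<open>A\<close>.\<close>
  define Y' where "Y' \<omega> = (\<lambda>i. if i \<in> {1..n} then Y i \<omega> else undefined)" for \<omega>
  have "Y' \<in> measurable M (Pi\<^sub>M UNIV (\<lambda>_. borel))"
  proof (rule measurable_PiM_single')
    show "(\<lambda>\<omega>. Y' \<omega> i) \<in> borel_measurable M" for i
      using Y by (cases "i \<in> {1..n}") (auto simp: Y'_def)
  qed (simp add: PiE_UNIV_domain)
  then have "Y' \<in> measurable M borel"
    by (simp add: measurable_def sets_PiM_equal_borel space_PiM PiE_UNIV_domain)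
  then have "Y' -` A \<inter> space M \<in> sets M"
    using A(1) by (rule measurable_sets)
  also have "Y' -` A \<inter> space M = {\<omega> \<in> space M. (\<lambda>i. Y i \<omega>) \<in> A}"
    using determined_byD[OF A(2), of "Y' _" "\<lambda>i. Y i _"] by (auto simp: Y'_def)
  finally show ?thesis .
qed

text \<open>Both sides equal the measure of \<open>A\<close> under the product of \<open>n\<close>
  copies of the density: independence and the marginals determine the joint law.\<close>

lemma measure_sample_eq:
  fixes X :: "nat \<Rightarrow> 'v \<Rightarrow> 'b::euclidean_space" and Y :: "nat \<Rightarrow> 'w \<Rightarrow> 'b"
  assumes "n > 0"
    and X: "prob_space M" "prob_space.indep_vars M (\<lambda>_. borel) X {1..n}"
      "\<And>i. i \<in> {1..n} \<Longrightarrow> distributed M lborel (X i) f"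
    and Y: "prob_space N" "prob_space.indep_vars N (\<lambda>_. borel) Y {1..n}"
      "\<And>i. i \<in> {1..n} \<Longrightarrow> distributed N lborel (Y i) f"
    and A: "A \<in> sets borel" "determined_by n A"
  shows "measure M {\<omega> \<in> space M. (\<lambda>i. X i \<omega>) \<in> A} = measure N {\<omega> \<in> space N. (\<lambda>i. Y i \<omega>) \<in> A}"
proof -
  let ?S = "Pi\<^sub>M {1..n} (\<lambda>_. borel :: 'b measure)"
  let ?D = "Pi\<^sub>M {1..n} (\<lambda>_. density lborel f)"
  let ?A = "{x \<in> space ?S. x \<in> A}"
  have setsA: "?A \<in> sets ?S"
    using sets_sample[OF A, of "\<lambda>i x. x i" ?S] by (simp add: measurable_component_singleton)
  have *: "measure K {\<omega> \<in> space K. (\<lambda>i. Z i \<omega>) \<in> A} = measure ?D ?A"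
    if K: "prob_space K" "prob_space.indep_vars K (\<lambda>_. borel) Z {1..n}"
      "\<And>i. i \<in> {1..n} \<Longrightarrow> distributed K lborel (Z i) f"
    for K :: "'k measure" and Z
  proof -
    interpret K: prob_space K by fact
    let ?Z = "\<lambda>\<omega>. \<lambda>i\<in>{1..n}. Z i \<omega>"
    have rv: "Z i \<in> borel_measurable K" if "i \<in> {1..n}" for i
      using distributed_measurable[OF K(3)[OF that]] by simp
    have "distr K ?S ?Z = Pi\<^sub>M {1..n} (\<lambda>i. distr K borel (Z i))"
      using K.indep_vars_iff_distr_eq_PiM'[of "{1..n}" Z "\<lambda>_. borel"] K(2) rv \<open>n > 0\<close> by simp
    also have "\<dots> = ?D"
    proof (rule PiM_cong)
      fix i assume "i \<in> {1..n}"
      have "distr K borel (Z i) = distr K lborel (Z i)"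
        by (rule distr_cong) auto
      then show "distr K borel (Z i) = density lborel f"
        using distributed_distr_eq_density[OF K(3)[OF \<open>i \<in> {1..n}\<close>]] by simp
    qed simp
    finally have "measure ?D ?A = measure (distr K ?S ?Z) ?A"
      by simp
    also have "\<dots> = measure K (?Z -` ?A \<inter> space K)"
      using setsA rv by (intro measure_distr measurable_restrict) auto
    also have "?Z -` ?A \<inter> space K = {\<omega> \<in> space K. (\<lambda>i. Z i \<omega>) \<in> A}"
      using determined_byD[OF A(2), of "?Z _" "\<lambda>i. Z i _"] by (auto simp: space_PiM)
    finally show ?thesis
      by simp
  qed
  show ?thesis
    using *[OF X] *[OF Y] by simp
qed

text \<open>An open set contains a box around each of its points. Its sides have positive
  probability, since nonempty open sets are not Lebesgue null and the density is positive;
  independence multiplies these probabilities.\<close>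

lemma measure_sample_open_pos:
  fixes X :: "nat \<Rightarrow> 'w \<Rightarrow> real^'p"
  assumes "n > 0"
    and X: "prob_space M" "prob_space.indep_vars M (\<lambda>_. borel) X {1..n}"
      "\<And>i. i \<in> {1..n} \<Longrightarrow> distributed M lborel (X i) (\<lambda>x. ennreal (f x))"
    and f: "\<And>x. f x > 0"
    and A: "open A" "A \<noteq> {}" "determined_by n A"
  shows "measure M {\<omega> \<in> space M. (\<lambda>i. X i \<omega>) \<in> A} > 0"
proof -
  interpret prob_space M by fact
  obtain a where "a \<in> A"
    using A(2) by blast
  then obtain U where U: "a \<in> PiE UNIV U" "\<And>i. open (U i)" "PiE UNIV U \<subseteq> A"
    using product_topology_open_contains_basis[of "\<lambda>_. euclidean" UNIV A a] A(1)
    by (auto simp: open_fun_def)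
  have rv: "X i \<in> borel_measurable M" if "i \<in> {1..n}" for i
    using distributed_measurable[OF X(3)[OF that]] by simp
  have pos: "prob (X i -` U i \<inter> space M) > 0" if i: "i \<in> {1..n}" for i
  proof (rule ccontr)
    have meas: "(\<lambda>x. ennreal (f x)) \<in> borel_measurable lborel"
      using distributed_borel_measurable[OF X(3)[OF i]] .
    assume "\<not> ?thesis"
    then have "emeasure M (X i -` U i \<inter> space M) = 0"
      by (simp add: emeasure_eq_measure zero_less_measure_iff)
    then have "emeasure (density lborel (\<lambda>x. ennreal (f x))) (U i) = 0"
      using U(2)[of i] distributed_measurable[OF X(3)[OF i]]
      by (simp add: emeasure_distr flip: distributed_distr_eq_density[OF X(3)[OF i]])
    then have "U i \<in> null_sets (density lborel (\<lambda>x. ennreal (f x)))"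
      using U(2)[of i] by (simp add: null_sets_def)
    then have "AE x in lborel. x \<notin> U i"
      using f by (auto simp: null_sets_density_iff[OF meas] ennreal_eq_0_iff not_le[symmetric])
    then have "U i \<in> null_sets lborel"
      using U(2)[of i] by (simp add: AE_iff_null_sets)
    then have "negligible (U i)"
      by (simp add: negligible_iff_null_sets null_sets_completionI)
    then show False
      using open_not_negligible[OF U(2)[of i]] U(1) by auto
  qed
  have "0 < (\<Prod>i\<in>{1..n}. prob (X i -` U i \<inter> space M))"
    using pos by (intro prod_pos) auto
  also have "\<dots> = prob (\<Inter>i\<in>{1..n}. X i -` U i \<inter> space M)"
    using \<open>n > 0\<close> U(2) by (intro indep_varsD_finite[OF X(2), symmetric]) auto
  also have "\<dots> \<le> prob {\<omega> \<in> space M. (\<lambda>i. X i \<omega>) \<in> A}"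
  proof (rule finite_measure_mono)
    show "(\<Inter>i\<in>{1..n}. X i -` U i \<inter> space M) \<subseteq> {\<omega> \<in> space M. (\<lambda>i. X i \<omega>) \<in> A}"
    proof
      fix \<omega> assume \<omega>: "\<omega> \<in> (\<Inter>i\<in>{1..n}. X i -` U i \<inter> space M)"
      \<comment> \<open>The box may also restrict unobserved coordinates; filling these in from
        \<open>a\<close> puts the point into the box.\<close>
      have "(\<lambda>i. if i \<in> {1..n} then X i \<omega> else a i) \<in> A"
        using PiE_mem[OF U(1)] \<omega> by (intro subsetD[OF U(3)]) (auto simp: PiE_UNIV_domain)
      then have "(\<lambda>i. X i \<omega>) \<in> A"
        using determined_byD[OF A(3), of "\<lambda>i. if i \<in> {1..n} then X i \<omega> else a i" "\<lambda>i. X i \<omega>"] by simp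
      then show "\<omega> \<in> {\<omega> \<in> space M. (\<lambda>i. X i \<omega>) \<in> A}"
        using \<omega> \<open>n > 0\<close> by auto
    qed
    show "{\<omega> \<in> space M. (\<lambda>i. X i \<omega>) \<in> A} \<in> events"
      using sets_sample[OF _ A(3) rv] A(1) by simp
  qed
  finally show ?thesis .
qed

lemma continuous_on_inner_wrt:
  assumes "continuous_on T f"
  shows "continuous_on T (\<lambda>y. inner_wrt S (f y) (f y))"
  unfolding inner_wrt_def
  by (intro continuous_intros assms continuous_on_compose2[OF matrix_vector_mult_linear_continuous_on assms]) auto

text \<open>A countable dense subset \<open>D\<close> of the cone replaces the uncountable choice of
  \<open>y\<close>. As the inequality is not strict, points of \<open>D\<close> are only asked to
  satisfy it up to every slack \<open>1 / real (Suc k)\<close>.\<close>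

lemma sets_LRT_rejects:
  fixes C :: "(real^'p) set"
  assumes C: "closed C" "convex_cone C" and "c > 0"
  shows "{x. LRT_rejects n C c x} \<in> sets borel"
proof -
  obtain D where D: "countable D" "D \<subseteq> C" "C \<subseteq> closure D"
    using separable by blast
  let ?z = "\<lambda>x :: nat \<Rightarrow> real^'p. sqrt n *\<^sub>R sample_mean n x"
  let ?S = "scatter n :: (nat \<Rightarrow> real^'p) \<Rightarrow> _"
  let ?Q = "\<lambda>x y. cramer_form (?S x) (?z x - y) / det (?S x)"
  have "LRT_rejects n C c x \<longleftrightarrow>
    det (?S x) \<noteq> 0 \<and> (\<forall>k. \<exists>y\<in>D. (1 + c) * ?Q x y + c < ?Q x 0 + 1 / real (Suc k))" for x
  proof (cases "det (?S x) = 0")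
    case False
    define z S where "z = ?z x" and "S = ?S x"
    have S: "pos_def S"
      using False by (simp add: S_def pos_def_scatter_iff)
    define p where "p = proj_wrt S C z"
    note proj = projection_wrt_convex_cone[OF S C, where z = z, folded p_def]
    let ?q = "\<lambda>y. inner_wrt S (z - y) (z - y)"
    have "(\<exists>y\<in>C. (1 + c) * ?q y + c \<le> ?q 0) \<longleftrightarrow>
      (\<forall>k. \<exists>y\<in>D. (1 + c) * ?q y + c < ?q 0 + 1 / real (Suc k))"
    proof (intro iffI allI)
      fix k assume "\<exists>y\<in>C. (1 + c) * ?q y + c \<le> ?q 0"
      then obtain y where y: "y \<in> C" "(1 + c) * ?q y + c \<le> ?q 0"
        by blast
      let ?V = "{y. (1 + c) * ?q y + c < ?q 0 + 1 / real (Suc k)}"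
      have "open ?V"
        by (intro open_Collect_less continuous_intros continuous_on_inner_wrt)
      moreover have "y \<in> ?V"
        using y(2) by (simp add: le_less_trans[OF y(2)])
      ultimately show "\<exists>y\<in>D. (1 + c) * ?q y + c < ?q 0 + 1 / real (Suc k)"
        using y(1) D(3) open_Int_closure_eq_empty[of ?V D] by blast
    next
      assume *: "\<forall>k. \<exists>y\<in>D. (1 + c) * ?q y + c < ?q 0 + 1 / real (Suc k)"
      \<comment> \<open>The projection does at least as well as every point of \<open>D\<close>, so
        this single point satisfies the inequality for every slack.\<close>
      have p: "(1 + c) * ?q p + c < ?q 0 + 1 / real (Suc k)" for k
      proof -
        obtain y where y: "y \<in> D" "(1 + c) * ?q y + c < ?q 0 + 1 / real (Suc k)"
          using * by blast
        have "(1 + c) * ?q p \<le> (1 + c) * ?q y"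
          using proj(2)[of y] y(1) D(2) \<open>c > 0\<close> by (intro mult_left_mono) auto
        with y(2) show ?thesis
          by linarith
      qed
      have "(1 + c) * ?q p + c \<le> ?q 0"
      proof (rule field_le_epsilon)
        fix e :: real assume "e > 0"
        then obtain k where "1 / real (Suc k) < e"
          using nat_approx_posE by blast
        with p[of k] show "(1 + c) * ?q p + c \<le> ?q 0 + e"
          by linarith
      qed
      then show "\<exists>y\<in>C. (1 + c) * ?q y + c \<le> ?q 0"
        using proj(1) by blast
    qed
    then show ?thesis
      using False S by (simp add: LRT_rejects_iff[OF C \<open>c > 0\<close>] inner_wrt_cramer z_def S_def)
  qed (simp add: LRT_rejects_def pos_def_scatter_iff)
  moreover have [measurable]: "(\<lambda>x. det (?S x)) \<in> borel_measurable borel"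
    "(\<lambda>x. cramer_form (?S x) (?z x - y)) \<in> borel_measurable borel" for y
    by (intro borel_measurable_continuous_onI continuous_on_det_scatter continuous_on_cramer_scatter)+
  have "{x \<in> space borel. det (?S x) \<noteq> 0 \<and>
      (\<forall>k. \<exists>y\<in>D. (1 + c) * ?Q x y + c < ?Q x 0 + 1 / real (Suc k))} \<in> sets borel"
    using D(1) by measurable
  ultimately show ?thesis
    by simp
qed

section \<open>Comparison of critical values\<close>

text \<open>Mean and scatter transform with \<open>B\<close> and the form is invariant, so
  transforming the sample amounts to replacing the cone by its preimage.\<close>

lemma LRT_rejects_linear:
  fixes C :: "(real^'p) set" and B :: "real^'p^'p"
  assumes C: "closed C" "convex_cone C" and "c > 0" and B: "invertible B"
  shows "LRT_rejects n C c (\<lambda>i. B *v x i) \<longleftrightarrow> pos_def (scatter n x) \<and>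
    (\<exists>y. B *v y \<in> C \<and>
      (1 + c) * inner_wrt (scatter n x) (sqrt n *\<^sub>R sample_mean n x - y) (sqrt n *\<^sub>R sample_mean n x - y) + c
        \<le> inner_wrt (scatter n x) (sqrt n *\<^sub>R sample_mean n x) (sqrt n *\<^sub>R sample_mean n x))"
proof -
  define S z where "S = scatter n x" and "z = sqrt n *\<^sub>R sample_mean n x"
  have scatter: "scatter n (\<lambda>i. B *v x i) = B ** S ** transpose B"
    unfolding S_def by (rule scatter_linear)
  have mean: "sqrt n *\<^sub>R sample_mean n (\<lambda>i. B *v x i) = B *v z"
    by (simp add: sample_mean_linear z_def matrix_vector_mult_scaleR)
  show ?thesis
  proof (cases "pos_def S")
    case True
    have Q: "inner_wrt (B ** S ** transpose B) (B *v v) (B *v v) = inner_wrt S v v" for v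
      using pos_def_invertible[OF True] B by (rule inner_wrt_congruence)
    have "surj ((*v) B)"
      using B by (simp add: invertible_right_inverse matrix_right_invertible_surjective)
    then have Bex: "(\<exists>y\<in>C. R y) \<longleftrightarrow> (\<exists>y. B *v y \<in> C \<and> R (B *v y))" for R
      by (auto simp: surj_def) metis
    show ?thesis
      unfolding LRT_rejects_iff[OF C \<open>c > 0\<close>] scatter mean pos_def_congruence_iff[OF B] Bex
        matrix_vector_mult_diff_distrib[symmetric] Q
      by (simp add: S_def z_def)
  next
    case False
    then have "\<not> pos_def (scatter n (\<lambda>i. B *v x i))"
      by (simp add: scatter pos_def_congruence_iff[OF B])
    with False show ?thesis
      by (simp add: LRT_rejects_def S_def)
  qed
qed

lemma closed_coord_halfspace: "closed (coord_halfspace l)"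
  unfolding coord_halfspace_def by (intro closed_Collect_le continuous_intros)

lemma convex_cone_coord_halfspace: "convex_cone (coord_halfspace l)"
  by (simp add: convex_cone_iff coord_halfspace_def)

lemma open_subset_coord_halfspace_pos:
  assumes "open U" "u \<in> U" "U \<subseteq> coord_halfspace l"
  shows "u $ l > 0"
proof -
  obtain e where e: "e > 0" "ball u e \<subseteq> U"
    using assms open_contains_ball by blast
  have "u - (e / 2) *\<^sub>R axis l 1 \<in> ball u e"
    using e(1) by (simp add: dist_norm norm_Basis axis_in_Basis_iff)
  then have "u - (e / 2) *\<^sub>R axis l 1 \<in> coord_halfspace l"
    using e(2) assms(3) by blast
  then show ?thesis
    using e(1) by (simp add: coord_halfspace_def)
qed

text \<open>The maps fix an interior direction \<open>u\<close> of the cone and shrink the boundary hyperplane of the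
  halfspace, so that the preimages of the cone exhaust the open halfspace.\<close>

lemma cone_preimages_exhaust_halfspace:
  fixes C :: "(real^'p) set"
  assumes C: "convex_cone C" "open U" "U \<subseteq> C" and u: "u \<in> U" "u $ l > 0"
  obtains B :: "nat \<Rightarrow> real^'p^'p" where "\<And>k. invertible (B k)"
    "\<And>y. y $ l > 0 \<Longrightarrow> \<forall>\<^sub>F k in sequentially. B k *v y \<in> C"
proof -
  \<comment> \<open>\<open>y\<close> is split into the multiple of \<open>u\<close> with the same
    \<open>l\<close>-th coordinate and a remainder in the boundary hyperplane, which is scaled by
    \<open>s\<close>. The maps for \<open>s\<close> and \<open>1 / s\<close> are inverse to each
    other when \<open>s\<close> is nonzero.\<close>
  define f where "f s y = (y $ l / u $ l) *\<^sub>R u + s *\<^sub>R (y - (y $ l / u $ l) *\<^sub>R u)" for s :: real and y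
  have lin: "linear (f s)" for s
    by (rule linearI) (simp_all add: f_def algebra_simps add_divide_distrib)
  have nth: "f s y $ l = y $ l" for s y
    using u(2) by (simp add: f_def)
  have comp: "f s (f t y) = f (s * t) y" for s t y
    unfolding f_def[of s] nth by (simp add: f_def)
  have one: "f 1 y = y" for y
    by (simp add: f_def)
  define B where "B k = matrix (f (1 / real (Suc k)))" for k
  have mult: "B k *v y = f (1 / real (Suc k)) y" for k y
    unfolding B_def by (simp add: matrix_works linear_matrix_vector_mul_eq lin)
  show ?thesis
  proof
    fix k
    show "invertible (B k)"
      unfolding B_def matrix_invertible[OF lin]
      by (intro exI[of _ "f (real (Suc k))"] conjI lin ext) (simp_all add: comp one del: of_nat_Suc)
  next
    fix y :: "real^'p" assume y: "y $ l > 0"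
    \<comment> \<open>Rescaling by \<open>?r\<close> makes the limit \<open>u\<close> itself, so
      that openness of \<open>U\<close> applies; the cone property then undoes the scaling.\<close>
    let ?r = "u $ l / y $ l"
    have "(\<lambda>k. ?r *\<^sub>R f (1 / real (Suc k)) y) \<longlonglongrightarrow>
      ?r *\<^sub>R ((y $ l / u $ l) *\<^sub>R u + 0 *\<^sub>R (y - (y $ l / u $ l) *\<^sub>R u))"
      unfolding f_def by (intro tendsto_intros LIMSEQ_Suc lim_1_over_n)
    then have "(\<lambda>k. ?r *\<^sub>R f (1 / real (Suc k)) y) \<longlonglongrightarrow> u"
      using y u(2) by simp
    then have "\<forall>\<^sub>F k in sequentially. ?r *\<^sub>R f (1 / real (Suc k)) y \<in> U"
      using C(2) u(1) by (rule topological_tendstoD)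
    then show "\<forall>\<^sub>F k in sequentially. B k *v y \<in> C"
    proof (rule eventually_mono)
      fix k assume "?r *\<^sub>R f (1 / real (Suc k)) y \<in> U"
      then have "(1 / ?r) *\<^sub>R (?r *\<^sub>R f (1 / real (Suc k)) y) \<in> C"
        using C(3) u(2) y by (subst convex_cone_scaleR[OF C(1)]) auto
      then show "B k *v y \<in> C"
        using u(2) y by (simp add: mult)
    qed
  qed
qed

text \<open>\<open>F\<close> lies in the lower limit of the sets \<open>A k\<close>, the increasing
  union of their tail intersections, each of measure at most \<open>a\<close>.\<close>

lemma (in finite_measure) measure_le_of_eventually_mem:
  assumes A: "\<And>k. A k \<in> sets M" "\<And>k. measure M (A k) \<le> a"
    and F: "\<And>\<omega>. \<omega> \<in> F \<Longrightarrow> \<forall>\<^sub>F k in sequentially. \<omega> \<in> A k"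
  shows "measure M F \<le> a"
proof -
  define G where "G m = (\<Inter>k\<in>{m..}. A k)" for m
  have G: "G m \<in> sets M" for m
    unfolding G_def using A(1) by (intro sets.countable_INT') auto
  have "incseq G"
    by (auto simp: incseq_def G_def)
  then have "(\<lambda>m. measure M (G m)) \<longlonglongrightarrow> measure M (\<Union>m. G m)"
    using G by (intro finite_Lim_measure_incseq) auto
  moreover have "measure M (G m) \<le> a" for m
    using finite_measure_mono[of "G m" "A m"] A[of m] by (auto simp: G_def intro: order_trans)
  ultimately have "measure M (\<Union>m. G m) \<le> a"
    by (intro LIMSEQ_le_const2) auto
  moreover have "F \<subseteq> (\<Union>m. G m)"
    using F by (fastforce simp: G_def eventually_sequentially)
  then have "measure M F \<le> measure M (\<Union>m. G m)"
    using G by (intro finite_measure_mono) auto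
  ultimately show ?thesis
    by linarith
qed

section \<open>Power under the null hypothesis\<close>

lemma normal_sampleD:
  assumes "normal_sample n P X" "pos_def \<Sigma>"
  shows "prob_space (P \<theta> \<Sigma>)"
    and "prob_space.indep_vars (P \<theta> \<Sigma>) (\<lambda>_. borel) X {1..n}"
    and "i \<in> {1..n} \<Longrightarrow> distributed (P \<theta> \<Sigma>) lborel (X i) (\<lambda>x. ennreal (mv_normal_density \<theta> \<Sigma> x))"
  using assms unfolding normal_sample_def by blast+

text \<open>The vectors \<open>B *v X i\<close> under the identity covariance have the joint law of
  the sample under \<open>B ** transpose B\<close>. Null covariances can thus be compared on one
  probability space.\<close>

lemma LRT_power_linear:
  fixes P :: "real^'p \<Rightarrow> real^'p^'p \<Rightarrow> 'w measure"
  assumes "n > 0" and P: "normal_sample n P X" and C: "closed C" "convex_cone C" and "c > 0"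
    and B: "invertible B"
  shows "LRT_power n P X C c 0 (B ** transpose B) =
    measure (P 0 (mat 1)) {\<omega> \<in> space (P 0 (mat 1)). LRT_rejects n C c (\<lambda>i. B *v X i \<omega>)}"
proof -
  have "pos_def (B ** transpose B)"
    using pos_def_congruence[OF pos_def_mat_1 B] by simp
  note Y = normal_sampleD[OF P this, where \<theta> = 0]
  note X = normal_sampleD[OF P pos_def_mat_1, where \<theta> = 0]
  have BX: "prob_space.indep_vars (P 0 (mat 1)) (\<lambda>_. borel) (\<lambda>i \<omega>. B *v X i \<omega>) {1..n}"
    using prob_space.indep_vars_compose2[OF X(1,2), of "\<lambda>_. (*v) B" "\<lambda>_. borel"] by simp
  show ?thesis
    unfolding LRT_power_def
    using measure_sample_eq[OF \<open>n > 0\<close> Y X(1) BX distributed_normal_linear[OF B X(3) Y(3) X(1) Y(1)]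
        sets_LRT_rejects[OF C \<open>c > 0\<close>] determined_by_LRT_rejects]
    by simp
qed

text \<open>The group of linear maps preserving the halfspace acts transitively on the covariances.\<close>

lemma LRT_power_halfspace_null:
  fixes P :: "real^'p \<Rightarrow> real^'p^'p \<Rightarrow> 'w measure"
  assumes "n > 0" "normal_sample n P X" "c > 0" "pos_def \<Sigma>"
  shows "LRT_power n P X (coord_halfspace l) c 0 \<Sigma> = LRT_power n P X (coord_halfspace l) c 0 (mat 1)"
proof -
  note H = closed_coord_halfspace[of l] convex_cone_coord_halfspace[of l]
  obtain B :: "real^'p^'p" and k where B: "invertible B" "\<Sigma> = B ** transpose B" and k: "k > 0" "\<And>x. (B *v x) $ l = k * x $ l"
    using pos_def_factorization[OF assms(4), of l] by blast
  have mem: "B *v y \<in> coord_halfspace l \<longleftrightarrow> y \<in> coord_halfspace l" for y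
    using k by (simp add: coord_halfspace_def zero_le_mult_iff)
  have "LRT_rejects n (coord_halfspace l) c (\<lambda>i. B *v x i) \<longleftrightarrow> LRT_rejects n (coord_halfspace l) c x" for x
    unfolding LRT_rejects_linear[OF H assms(3) B(1)] LRT_rejects_iff[OF H assms(3)] mem Bex_def ..
  then show ?thesis
    unfolding B(2) LRT_power_linear[OF assms(1,2) H assms(3) B(1)] by (simp add: LRT_power_def)
qed

lemma LRT_power_le_critical:
  assumes "normal_sample n P X" "LRT_critical_value n P X C \<alpha> c" "pos_def \<Sigma>"
  shows "LRT_power n P X C c 0 \<Sigma> \<le> \<alpha>"
proof -
  have "LRT_power n P X C c 0 \<Sigma>' \<le> 1" if "pos_def \<Sigma>'" for \<Sigma>'
    using assms(1) that unfolding LRT_power_def normal_sample_def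
    by (intro prob_space.prob_le_1) blast
  then have "bdd_above ((\<lambda>\<Sigma>. LRT_power n P X C c 0 \<Sigma>) ` {\<Sigma>. pos_def \<Sigma>})"
    by (intro bdd_aboveI[of _ 1]) auto
  then have "LRT_power n P X C c 0 \<Sigma> \<le> (SUP \<Sigma>\<in>{\<Sigma>. pos_def \<Sigma>}. LRT_power n P X C c 0 \<Sigma>)"
    using assms(3) by (intro cSUP_upper) auto
  then show ?thesis
    using assms(2) by (simp add: LRT_critical_value_def)
qed

text \<open>The preimages of the cone exhaust the open halfspace; this moves a witness off the
  boundary.\<close>

lemma open_halfspace_approx:
  fixes y :: "real^'p"
  assumes "open V" "y \<in> V" "y $ l \<ge> 0"
  obtains y' where "y' \<in> V" "y' $ l > 0"
proof -
  obtain e where e: "e > 0" "ball y e \<subseteq> V"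
    using assms open_contains_ball by blast
  show ?thesis
  proof
    show "y + (e / 2) *\<^sub>R axis l 1 \<in> V"
      using e by (intro subsetD[OF e(2)]) (simp add: dist_norm norm_Basis axis_in_Basis_iff)
    show "(y + (e / 2) *\<^sub>R axis l 1) $ l > 0"
      using e(1) assms(3) by simp
  qed
qed

text \<open>Strictness leaves room to move \<open>y\<close> into the open halfspace, where the maps
  \<open>B k\<close> eventually take it into the cone.\<close>

lemma eventually_LRT_rejects:
  fixes C :: "(real^'p) set" and x :: "nat \<Rightarrow> real^'p" and n :: nat
  defines "z \<equiv> sqrt n *\<^sub>R sample_mean n x"
  assumes C: "closed C" "convex_cone C" and "c > 0"
    and B: "\<And>k. invertible (B k)" "\<And>y. y $ l > 0 \<Longrightarrow> \<forall>\<^sub>F k in sequentially. B k *v y \<in> C"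
    and x: "pos_def (scatter n x)"
    and y: "y $ l \<ge> 0" "(1 + c) * inner_wrt (scatter n x) (z - y) (z - y) + c < inner_wrt (scatter n x) (z) (z)"
  shows "\<forall>\<^sub>F k in sequentially. LRT_rejects n C c (\<lambda>i. B k *v x i)"
proof -
  let ?V = "{y. (1 + c) * inner_wrt (scatter n x) (z - y) (z - y) + c < inner_wrt (scatter n x) (z) (z)}"
  have "open ?V"
    by (intro open_Collect_less continuous_intros continuous_on_inner_wrt)
  then obtain y' where y': "y' \<in> ?V" "y' $ l > 0"
    using open_halfspace_approx[of ?V y l] y by blast
  from B(2)[OF y'(2)] show ?thesis
  proof (rule eventually_mono)
    fix k assume "B k *v y' \<in> C"
    then show "LRT_rejects n C c (\<lambda>i. B k *v x i)"
      unfolding LRT_rejects_linear[OF C \<open>c > 0\<close> B(1)]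
      using x y'(1) by (auto simp: z_def intro!: exI[of _ y'])
  qed
qed

text \<open>Here \<open>z\<close> is its own projection onto the halfspace, so the statistic is its
  squared norm: the halfspace test rejects these samples at critical value \<open>a\<close> but not
  at \<open>b\<close>.\<close>

definition levels_between :: "nat \<Rightarrow> 'p \<Rightarrow> real \<Rightarrow> real \<Rightarrow> (nat \<Rightarrow> real^'p) set" where
  "levels_between n l a b = {x. pos_def (scatter n x) \<and> sample_mean n x $ l > 0 \<and>
     inner_wrt (scatter n x) (sqrt n *\<^sub>R sample_mean n x) (sqrt n *\<^sub>R sample_mean n x) \<in> {a<..<b}}"

lemma open_levels_between: "open (levels_between n l a b :: (nat \<Rightarrow> real^'p) set)"
proof -
  let ?T = "{x :: nat \<Rightarrow> real^'p. det (scatter n x) \<noteq> 0}"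
  let ?g = "\<lambda>x :: nat \<Rightarrow> real^'p. cramer_form (scatter n x) (sqrt n *\<^sub>R sample_mean n x) / det (scatter n x)"
  have T: "open ?T"
    by (intro open_Collect_neq continuous_on_det_scatter continuous_on_const)
  have "continuous_on UNIV (\<lambda>x :: nat \<Rightarrow> real^'p. cramer_form (scatter n x) (sqrt n *\<^sub>R sample_mean n x))"
    using continuous_on_cramer_scatter[of n 0] by simp
  then have "continuous_on ?T ?g"
    by (intro continuous_on_divide) (auto intro: continuous_on_subset continuous_on_det_scatter)
  then have "open (?T \<inter> ?g -` {a<..<b})"
    using T by (intro continuous_open_preimage) auto
  moreover have "open {x :: nat \<Rightarrow> real^'p. 0 < sample_mean n x $ l}"
    by (intro open_Collect_less continuous_intros continuous_on_sample_mean)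
  moreover have "levels_between n l a b = (?T \<inter> ?g -` {a<..<b}) \<inter> {x. 0 < sample_mean n x $ l}"
    by (auto simp: levels_between_def pos_def_scatter_iff inner_wrt_cramer)
  ultimately show ?thesis
    by (simp add: open_Int)
qed

lemma determined_by_levels_between: "determined_by n (levels_between n l a b)"
  unfolding determined_by_def
proof (intro allI impI)
  fix x y :: "nat \<Rightarrow> real^'a"
  assume "\<forall>i\<in>{1..n}. x i = y i" and "x \<in> levels_between n l a b"
  then show "y \<in> levels_between n l a b"
    using scatter_cong[of n x y] by (simp add: levels_between_def)
qed

text \<open>Translation changes the mean but not the scatter matrix, so the given sample can be
  moved until its mean lies on the positive \<open>l\<close>-th axis at a suitable distance.\<close>

lemma levels_between_nonempty:
  fixes x :: "nat \<Rightarrow> real^'p"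
  assumes "n > 0" "0 < a" "a < b" and x: "pos_def (scatter n x)"
  shows "levels_between n l a b \<noteq> ({} :: (nat \<Rightarrow> real^'p) set)"
proof -
  obtain f :: "real^'p \<Rightarrow> real^'p" where f: "linear f" "inj f"
    "\<And>v w. inner_wrt (scatter n x) v w = f v \<bullet> f w"
    using pos_def_linear_coordinates[OF x] by blast
  let ?e = "axis l 1 :: real^'p"
  define q where "q = f ?e \<bullet> f ?e"
  have "f ?e \<noteq> 0"
    using f(1,2) linear_injective_0[of f] axis_eq_0_iff[of l "1::real"] by (metis zero_neq_one)
  then have q: "q > 0"
    by (simp add: q_def)
  define m where "m = (a + b) / 2"
  have m: "m \<in> {a<..<b}" "m > 0"
    using assms(2,3) by (auto simp: m_def field_simps)
  \<comment> \<open>Chosen so that the squared norm of the scaled mean is the midpoint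
    \<open>m\<close>.\<close>
  define t where "t = sqrt (m / (n * q))"
  have t: "t > 0" "real n * t\<^sup>2 * q = m"
    using m q assms(1) by (simp_all add: t_def)
  define x' where "x' i = x i + (t *\<^sub>R ?e - sample_mean n x)" for i
  have mean: "sample_mean n x' = t *\<^sub>R ?e"
    using sample_mean_translate[OF assms(1), of x] by (simp add: x'_def[abs_def])
  have scatter: "scatter n x' = scatter n x"
    using scatter_translate[OF assms(1), of x] by (simp add: x'_def[abs_def])
  have "inner_wrt (scatter n x) (sqrt n *\<^sub>R t *\<^sub>R ?e) (sqrt n *\<^sub>R t *\<^sub>R ?e) = real n * t\<^sup>2 * q"
    by (simp add: f(3) linear_scale[OF f(1)] q_def power2_eq_square)
  then have "x' \<in> levels_between n l a b"
    using x t m(1) by (simp add: levels_between_def mean scatter)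
  then show ?thesis
    by blast
qed

lemma mv_normal_density_pos: "mv_normal_density \<theta> (mat 1) x > 0"
  by (simp add: mv_normal_density_def)

lemma critical_value_halfspace_le:
  fixes P :: "real^'p \<Rightarrow> real^'p^'p \<Rightarrow> 'w measure" and C :: "(real^'p) set"
  assumes n: "n > 0" and P: "normal_sample n P X" and C: "closed C" "convex_cone C"
    and U: "open U" "U \<noteq> {}" "U \<subseteq> coord_halfspace l" "U \<subseteq> C"
    and "0 < \<alpha>"
    and cC: "LRT_critical_value n P X C \<alpha> c\<^sub>C"
    and cH: "LRT_critical_value n P X (coord_halfspace l) \<alpha> c\<^sub>H"
  shows "c\<^sub>H \<le> c\<^sub>C"
proof (rule ccontr)
  assume "\<not> ?thesis"
  then have less: "c\<^sub>C < c\<^sub>H"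
    by simp
  have pos: "c\<^sub>C > 0" "c\<^sub>H > 0"
    using cC cH by (auto simp: LRT_critical_value_def)
  let ?H = "coord_halfspace l :: (real^'p) set"
  note H = closed_coord_halfspace[of l] convex_cone_coord_halfspace[of l]
  define M where "M = P 0 (mat 1)"
  note X = normal_sampleD[OF P pos_def_mat_1, where \<theta> = 0, folded M_def]
  interpret prob_space M by (rule X(1))
  have rv [measurable]: "X i \<in> borel_measurable M" if "i \<in> {1..n}" for i
    using distributed_measurable[OF X(3)[OF that]] by simp
  let ?Q = "\<lambda>x v. inner_wrt (scatter n x) v v"
  let ?z = "\<lambda>x :: nat \<Rightarrow> real^'p. sqrt n *\<^sub>R sample_mean n x"
  define R where "R = {\<omega> \<in> space M. LRT_rejects n ?H c\<^sub>H (\<lambda>i. X i \<omega>)}"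
  define E where "E = {\<omega> \<in> space M. (\<lambda>i. X i \<omega>) \<in> levels_between n l c\<^sub>C c\<^sub>H}"
  have R: "R \<in> events"
    using sets_sample[OF sets_LRT_rejects[OF H pos(2)] determined_by_LRT_rejects rv] by (simp add: R_def)
  have E: "E \<in> events"
    using sets_sample[OF _ determined_by_levels_between rv] open_levels_between[of n l c\<^sub>C c\<^sub>H] by (simp add: E_def)
  \<comment> \<open>The null power of the halfspace test is constant, so the supremum is its value
    at the identity covariance and \<open>R\<close> has probability exactly \<alpha>.\<close>
  have "(SUP \<Sigma>\<in>{\<Sigma>. pos_def \<Sigma>}. LRT_power n P X ?H c\<^sub>H 0 \<Sigma>)
      = (SUP \<Sigma>\<in>{\<Sigma> :: real^'p^'p. pos_def \<Sigma>}. LRT_power n P X ?H c\<^sub>H 0 (mat 1))"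
    using LRT_power_halfspace_null[OF n P pos(2)] by (intro SUP_cong) auto
  also have "\<dots> = LRT_power n P X ?H c\<^sub>H 0 (mat 1)"
    using pos_def_mat_1 by (intro cSUP_const) auto
  finally have prob_R: "prob R = \<alpha>"
    using cH by (simp add: LRT_critical_value_def LRT_power_def R_def M_def)
  with \<open>0 < \<alpha>\<close> have "R \<noteq> {}"
    by auto
  \<comment> \<open>Positivity of \<alpha> makes \<open>R\<close> nonempty, which supplies a sample
    with positive definite scatter matrix.\<close>
  then obtain x0 :: "nat \<Rightarrow> real^'p" where "pos_def (scatter n x0)"
    by (auto simp: R_def LRT_rejects_def)
  then have prob_E: "prob E > 0"
    unfolding E_def using n pos less
    by (intro measure_sample_open_pos[OF n X mv_normal_density_pos]
        open_levels_between levels_between_nonempty determined_by_levels_between) auto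
  have "R \<inter> E = {}"
  proof -
    have False if rejects: "LRT_rejects n ?H c\<^sub>H x" and x: "x \<in> levels_between n l c\<^sub>C c\<^sub>H" for x
    proof -
      have S: "pos_def (scatter n x)" and Q: "?Q x (?z x) < c\<^sub>H"
        using x by (auto simp: levels_between_def)
      obtain y where "(1 + c\<^sub>H) * ?Q x (?z x - y) + c\<^sub>H \<le> ?Q x (?z x)"
        using rejects unfolding LRT_rejects_iff[OF H pos(2)] by blast
      moreover have "(1 + c\<^sub>H) * ?Q x (?z x - y) \<ge> 0"
        using pos by (intro mult_nonneg_nonneg inner_wrt_nonneg S) auto
      ultimately show False
        using Q by linarith
    qed
    then show ?thesis
      by (auto simp: R_def E_def)
  qed
  then have prob_RE: "prob (R \<union> E) = \<alpha> + prob E"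
    using R E prob_R by (simp add: finite_measure_Union)
  obtain u where u: "u \<in> U"
    using U(2) by blast
  obtain B :: "nat \<Rightarrow> real^'p^'p" where B: "\<And>k. invertible (B k)"
    "\<And>y. y $ l > 0 \<Longrightarrow> \<forall>\<^sub>F k in sequentially. B k *v y \<in> C"
    using cone_preimages_exhaust_halfspace[OF C(2) U(1,4) u open_subset_coord_halfspace_pos[OF U(1) u U(3)]]
    by blast
  define A where "A k = {\<omega> \<in> space M. LRT_rejects n C c\<^sub>C (\<lambda>i. B k *v X i \<omega>)}" for k
  have A: "A k \<in> events" for k
    using sets_sample[OF sets_LRT_rejects[OF C pos(1)] determined_by_LRT_rejects, of n "\<lambda>i \<omega>. B k *v X i \<omega>" M]
    by (simp add: A_def rv)
  have prob_A: "prob (A k) \<le> \<alpha>" for k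
    using LRT_power_le_critical[OF P cC pos_def_congruence[OF pos_def_mat_1 B(1)[of k]]]
      LRT_power_linear[OF n P C pos(1) B(1)[of k]]
    by (simp add: A_def M_def)
  have "\<forall>\<^sub>F k in sequentially. \<omega> \<in> A k" if \<omega>: "\<omega> \<in> R \<union> E" for \<omega>
  proof -
    let ?x = "\<lambda>i. X i \<omega>"
    \<comment> \<open>On \<open>R\<close> the same \<open>y\<close> works, with strictness from
      \<open>c\<^sub>C < c\<^sub>H\<close>; on \<open>E\<close> the choice of \<open>y\<close> as
      the scaled mean makes the distance vanish.\<close>
    have "pos_def (scatter n ?x) \<and> (\<exists>y. y $ l \<ge> 0 \<and> (1 + c\<^sub>C) * ?Q ?x (?z ?x - y) + c\<^sub>C < ?Q ?x (?z ?x))"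
    proof (cases "\<omega> \<in> R")
      case True
      then obtain y where S: "pos_def (scatter n ?x)" and y: "y \<in> ?H"
        "(1 + c\<^sub>H) * ?Q ?x (?z ?x - y) + c\<^sub>H \<le> ?Q ?x (?z ?x)"
        by (auto simp: R_def LRT_rejects_iff[OF H pos(2)])
      have "(1 + c\<^sub>C) * ?Q ?x (?z ?x - y) \<le> (1 + c\<^sub>H) * ?Q ?x (?z ?x - y)"
        using less by (intro mult_right_mono inner_wrt_nonneg S) auto
      then show ?thesis
        using S y less by (intro conjI exI[of _ y]) (auto simp: coord_halfspace_def)
    next
      case False
      then have "?x \<in> levels_between n l c\<^sub>C c\<^sub>H"
        using \<omega> by (simp add: E_def)
      then show ?thesis
        by (intro conjI exI[of _ "?z ?x"]) (auto simp: levels_between_def inner_wrt_def)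
    qed
    then obtain y where "pos_def (scatter n ?x)" "y $ l \<ge> 0"
      "(1 + c\<^sub>C) * ?Q ?x (?z ?x - y) + c\<^sub>C < ?Q ?x (?z ?x)"
      by blast
    then have "\<forall>\<^sub>F k in sequentially. LRT_rejects n C c\<^sub>C (\<lambda>i. B k *v ?x i)"
      by (intro eventually_LRT_rejects[OF C pos(1) B])
    moreover have "\<omega> \<in> space M"
      using \<omega> by (auto simp: R_def E_def)
    ultimately show ?thesis
      by (simp add: A_def)
  qed
  then have "prob (R \<union> E) \<le> \<alpha>"
    by (rule measure_le_of_eventually_mem[OF A prob_A])
  with prob_RE prob_E show False
    by simp
qed

theorem proposition3p2:
  fixes P :: "real^'p \<Rightarrow> real^'p^'p \<Rightarrow> 'w measure"
    and X :: "nat \<Rightarrow> 'w \<Rightarrow> real^'p"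
    and C U :: "(real^'p) set"
    and l :: 'p
    and n :: nat
    and \<alpha> c\<^sub>C c\<^sub>H :: real
  assumes "CARD('p) < n"
    and "normal_sample n P X"
    and "closed C" and "convex_cone C"
    and "open U" and "U \<noteq> {}" and "U \<subseteq> coord_halfspace l"
    and "U \<subseteq> C" and "C \<subseteq> coord_halfspace l"
    and "0 < \<alpha>" and "\<alpha> < 1"
    and "LRT_critical_value n P X C \<alpha> c\<^sub>C"
    and "LRT_critical_value n P X (coord_halfspace l) \<alpha> c\<^sub>H"
  shows "\<forall>\<theta>\<in>C - {0}. \<forall>\<Sigma>. pos_def \<Sigma> \<longrightarrow>
           LRT_power n P X C c\<^sub>C \<theta> \<Sigma> \<le> LRT_power n P X (coord_halfspace l) c\<^sub>H \<theta> \<Sigma>"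
proof (intro ballI allI impI)
  fix \<theta> :: "real^'p" and \<Sigma> :: "real^'p^'p"
  assume "pos_def \<Sigma>"
  then interpret prob_space "P \<theta> \<Sigma>"
    using assms(2) by (simp add: normal_sample_def)
  have rv: "X i \<in> borel_measurable (P \<theta> \<Sigma>)" if "i \<in> {1..n}" for i
    using distributed_measurable[OF normal_sampleD(3)[OF assms(2) \<open>pos_def \<Sigma>\<close> that]] by simp
  have pos: "c\<^sub>C > 0" "c\<^sub>H > 0"
    using assms(12,13) by (auto simp: LRT_critical_value_def)
  have "c\<^sub>H \<le> c\<^sub>C"
    using assms by (intro critical_value_halfspace_le[of n P X C U l]) auto
  note H = closed_coord_halfspace[of l] convex_cone_coord_halfspace[of l]
  \<comment> \<open>The witness in \<open>C\<close> also lies in the halfspace and a smaller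
    critical value weakens the inequality, so the rejection regions are nested sample by
    sample.\<close>
  have "LRT_rejects n (coord_halfspace l) c\<^sub>H x" if rejects: "LRT_rejects n C c\<^sub>C x" for x
  proof -
    let ?Q = "\<lambda>v. inner_wrt (scatter n x) v v"
    let ?z = "sqrt n *\<^sub>R sample_mean n x"
    obtain y where S: "pos_def (scatter n x)" and y: "y \<in> C" "(1 + c\<^sub>C) * ?Q (?z - y) + c\<^sub>C \<le> ?Q ?z"
      using rejects unfolding LRT_rejects_iff[OF assms(3,4) pos(1)] by blast
    have "(1 + c\<^sub>H) * ?Q (?z - y) \<le> (1 + c\<^sub>C) * ?Q (?z - y)"
      using \<open>c\<^sub>H \<le> c\<^sub>C\<close> by (intro mult_right_mono inner_wrt_nonneg S) auto
    then have "(1 + c\<^sub>H) * ?Q (?z - y) + c\<^sub>H \<le> ?Q ?z"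
      using y(2) \<open>c\<^sub>H \<le> c\<^sub>C\<close> by linarith
    then show ?thesis
      unfolding LRT_rejects_iff[OF H pos(2)] using S y(1) assms(9) by blast
  qed
  moreover have "{\<omega> \<in> space (P \<theta> \<Sigma>). LRT_rejects n (coord_halfspace l) c\<^sub>H (\<lambda>i. X i \<omega>)} \<in> events"
    using sets_sample[OF sets_LRT_rejects[OF H pos(2)] determined_by_LRT_rejects rv] by simp
  ultimately show "LRT_power n P X C c\<^sub>C \<theta> \<Sigma> \<le> LRT_power n P X (coord_halfspace l) c\<^sub>H \<theta> \<Sigma>"
    unfolding LRT_power_def by (intro finite_measure_mono) auto
qed

end
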